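(* Let $0<q<1$, $\alpha\in[0,1]$, and let $p_{k,q}^{(\alpha,n)}(x)=\sum_{j=0}^k c_{n,q}(j,k)x^j$, $k=0,1,\ldots,n$, be the monic eigenvectors of $T_{n,q,\alpha}$. Then for all integers $k\ge0$ and $0\le j\le k$, $$\lim_{n\to\infty}c_{n,q}(j,k)=b_q(j,k),$$ where $$b_q(j,k)=\begin{cases}1,& j=k,\\ 0,& j=k-1=0,\\ \displaystyle\sum_{i=j+1}^k\frac{(1-q)^{i-j}S_q(i,j)}{q^{(k-j)(k+j-1)/2}-1}\,b_q(i,k),&\text{otherwise.}\end{cases}$$ In other words, for every $k\ge0$, $$\lim_{n\to\infty}p_{k,q}^{(\alpha,n)}(x)=p_k(x)=\sum_{j=0}^k b_q(j,k)x^j\quad\text{uniformly on }[0,1].$$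
   Context: For $q>0$: $[0]_q=0$, $[m]_q=1+q+\cdots+q^{m-1}$ for $m\ge1$; $[0]_q!=1$, $[m]_q!=[1]_q[2]_q\cdots[m]_q$. The $q$-binomial coefficient is $\left[{m\atop k}\right]_q=\frac{[m]_q!}{[k]_q!\,[m-k]_q!}$ for $0\le k\le m$, and it is $0$ for $k<0$ or $k>m$. Also $(x;q)_0=1$, $(x;q)_k=\prod_{s=0}^{k-1}(1-xq^s)$. For $n\ge2$, the $(\alpha,q)$-Bernstein operator $T_{n,q,\alpha}$ maps a function $f$ on $[0,1]$ to the polynomial $$T_{n,q,\alpha}(f;x)=\sum_{i=0}^n f\!\left(\frac{[i]_q}{[n]_q}\right)p_{n,q,i}^{(\alpha)}(x),$$ $$p_{n,q,i}^{(\alpha)}(x)=\left(\left[{n-2\atop i}\right]_q\frac{(1-\alpha)x}{1-q^{n-i-1}x}+\left[{n-2\atop i-2}\right]_q(1-\alpha)q^{n-i}+\left[{n\atop i}\right]_q\alpha x\right)x^{i-1}(x;q)_{n-i},$$ understood as a polynomial in $x$ after cancellation (terms with a zero $q$-binomial coefficient are omitted). The eigenvalues are $\lambda_{0,q}^{(\alpha,n)}=\lambda_{1,q}^{(\alpha,n)}=1$ and, for $2\le k\le n$, $$\lambda_{k,q}^{(\alpha,n)}=\frac{q^{k(k-1)/2}[n-2]_q!}{[n-k]_q![n]_q^k}\Big((1-\alpha)[n-k]_q[n-1+k]_q+\alpha[n]_q[n-1]_q\Big).$$ $p_{k,q}^{(\alpha,n)}$ is the monic polynomial of degree $k$ with $T_{n,q,\alpha}(p_{k,q}^{(\alpha,n)};x)=\lambda_{k,q}^{(\alpha,n)}p_{k,q}^{(\alpha,n)}(x)$,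 with the choices $p_{0,q}^{(\alpha,n)}=1$, $p_{1,q}^{(\alpha,n)}=x$. Its coefficients are $c_{n,q}(j,k)$ (so $c_{n,q}(k,k)=1$, $c_{n,q}(0,1)=0$); for $2\le k\le n$ they satisfy $$c_{n,q}(k-j,k)=\frac{1}{\lambda_{k,q}^{(\alpha,n)}-\lambda_{k-j,q}^{(\alpha,n)}}\sum_{i=0}^{j-1}c_{n,q}(k-i,k)\,a_{n,q}(k-j,k-i),\qquad j=1,\ldots,k,$$ where $a_{n,q}(r,m)$ is the coefficient of $x^r$ in $T_{n,q,\alpha}(t^m;x)$. The $q$-Stirling numbers of the second kind are $S_q(k,r)=\frac{1}{[r]_q!\,q^{r(r-1)/2}}\sum_{i=0}^r(-1)^iq^{i(i-1)/2}\left[{r\atop i}\right]_q[r-i]_q^k$ (with $0^0=1$); in particular $S_q(0,0)=1$, $S_q(k,0)=0$ for $k>0$, $S_q(k,r)=0$ for $k<r$. Limits are over $n\ge\max(k,2)$. *)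

theory Defs
  imports "HOL-Analysis.Analysis" "HOL-Computational_Algebra.Polynomial"
begin

definition q_int :: "real \<Rightarrow> nat \<Rightarrow> real" where
  "q_int q m = (\<Sum>i<m. q ^ i)"

definition q_fact :: "real \<Rightarrow> nat \<Rightarrow> real" where
  "q_fact q m = (\<Prod>i=1..m. q_int q i)"

text \<open>The lower index is an integer because the operator uses the index \<open>i - 2\<close> for all
  \<open>i \<ge> 0\<close>, with value \<open>0\<close> when it is negative.\<close>

definition q_binom :: "real \<Rightarrow> nat \<Rightarrow> int \<Rightarrow> real" where
  "q_binom q m k =
     (if 0 \<le> k \<and> k \<le> int m
      then q_fact q m / (q_fact q (nat k) * q_fact q (m - nat k)) else 0)"

definition q_pochhammer :: "'a::comm_ring_1 \<Rightarrow> 'a \<Rightarrow> nat \<Rightarrow> 'a" where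
  "q_pochhammer x q k = (\<Prod>s<k. 1 - x * q ^ s)"

text \<open>The polynomial basis, after cancelling \<open>1 - q^(n-i-1) x\<close> (the last factor of
  \<open>(x;q)_(n-i)\<close>) and one factor \<open>x\<close>. Wherever a natural number subtraction below truncates
  for \<open>i \<le> n\<close>, the accompanying q-binomial coefficient is zero. The lemma
  \<open>poly_aq_basis\<close> relates this to the uncancelled formula.\<close>

definition aq_basis :: "real \<Rightarrow> real \<Rightarrow> nat \<Rightarrow> nat \<Rightarrow> real poly" where
  "aq_basis q \<alpha> n i =
     smult (q_binom q (n - 2) (int i) * (1 - \<alpha>))
       ([:0, 1:] ^ i * q_pochhammer [:0, 1:] [:q:] (n - i - 1))
   + smult (q_binom q (n - 2) (int i - 2) * (1 - \<alpha>) * q ^ (n - i))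
       ([:0, 1:] ^ (i - 1) * q_pochhammer [:0, 1:] [:q:] (n - i))
   + smult (q_binom q n (int i) * \<alpha>)
       ([:0, 1:] ^ i * q_pochhammer [:0, 1:] [:q:] (n - i))"

lemma poly_q_pochhammer:
  "poly (q_pochhammer [:0, 1:] [:q:] k) x = q_pochhammer x (q::real) k"
  by (simp add: q_pochhammer_def poly_prod poly_power)

lemma poly_aq_basis:
  fixes q \<alpha> x :: real
  assumes "2 \<le> n" "i \<le> n" "x \<noteq> 0" and "i < n \<Longrightarrow> q ^ (n - i - 1) * x \<noteq> 1"
  shows "poly (aq_basis q \<alpha> n i) x =
    (q_binom q (n - 2) (int i) * ((1 - \<alpha>) * x / (1 - q powi (int n - int i - 1) * x))
     + q_binom q (n - 2) (int i - 2) * (1 - \<alpha>) * q ^ (n - i)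
     + q_binom q n (int i) * \<alpha> * x)
    * x powi (int i - 1) * q_pochhammer x q (n - i)"
proof -
  have pow: "x ^ i = x * x powi (int i - 1)"
    using assms(3) by (simp add: power_int_diff)
  have t1: "q_binom q (n - 2) (int i) * q_pochhammer x q (n - i - 1) =
      q_binom q (n - 2) (int i) * (q_pochhammer x q (n - i) / (1 - q powi (int n - int i - 1) * x))"
  proof (cases "i < n")
    case True
    then obtain m where m: "n - i = Suc m" by (metis Suc_diff_Suc)
    then have e: "int n - int i - 1 = int m" by linarith
    have "1 - q ^ m * x \<noteq> 0" using assms(4)[OF True] m by simp
    then show ?thesis
      by (simp add: e m q_pochhammer_def mult.commute)
  next
    case False
    then show ?thesis using assms(1,2) by (simp add: q_binom_def)
  qed
  have t2: "q_binom q (n - 2) (int i - 2) * x ^ (i - 1) =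
      q_binom q (n - 2) (int i - 2) * x powi (int i - 1)"
  proof (cases "2 \<le> i")
    case True
    then have "int i - 1 = int (i - 1)" by simp
    then show ?thesis by (metis power_int_of_nat)
  next
    case False
    then show ?thesis by (simp add: q_binom_def)
  qed
  have "poly (aq_basis q \<alpha> n i) x =
      (1 - \<alpha>) * x ^ i * (q_binom q (n - 2) (int i) * q_pochhammer x q (n - i - 1))
    + (q_binom q (n - 2) (int i - 2) * x ^ (i - 1)) * (1 - \<alpha>) * q ^ (n - i) * q_pochhammer x q (n - i)
    + q_binom q n (int i) * \<alpha> * x ^ i * q_pochhammer x q (n - i)"
    by (simp add: aq_basis_def poly_q_pochhammer poly_power algebra_simps)
  then show ?thesis
    unfolding t1 t2 pow by (simp add: algebra_simps)
qed

text \<open>Only the values of \<open>f\<close> at the nodes \<open>[i]/[n]\<close>, which lie in \<open>[0,1]\<close>, are used.\<close>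

definition aq_bernstein :: "real \<Rightarrow> real \<Rightarrow> nat \<Rightarrow> (real \<Rightarrow> real) \<Rightarrow> real poly" where
  "aq_bernstein q \<alpha> n f = (\<Sum>i\<le>n. smult (f (q_int q i / q_int q n)) (aq_basis q \<alpha> n i))"

definition aq_eigenvalue :: "real \<Rightarrow> real \<Rightarrow> nat \<Rightarrow> nat \<Rightarrow> real" where
  "aq_eigenvalue q \<alpha> n k =
     (if k \<le> 1 then 1
      else q ^ (k * (k - 1) div 2) * q_fact q (n - 2) / (q_fact q (n - k) * q_int q n ^ k)
        * ((1 - \<alpha>) * q_int q (n - k) * q_int q (n - 1 + k)
           + \<alpha> * q_int q n * q_int q (n - 1)))"

text \<open>Meaningful for \<open>n \<ge> max k 2\<close>. For \<open>k \<le> 1\<close> the eigenvalue \<open>1\<close> is double, so the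
  eigenvector is a choice.\<close>

definition aq_eigenvector :: "real \<Rightarrow> real \<Rightarrow> nat \<Rightarrow> nat \<Rightarrow> real poly" where
  "aq_eigenvector q \<alpha> n k =
     (if k = 0 then 1
      else if k = 1 then [:0, 1:]
      else (THE p. degree p = k \<and> lead_coeff p = 1 \<and>
              aq_bernstein q \<alpha> n (poly p) = smult (aq_eigenvalue q \<alpha> n k) p))"

definition q_stirling :: "real \<Rightarrow> nat \<Rightarrow> nat \<Rightarrow> real" where
  "q_stirling q k r =
     1 / (q_fact q r * q ^ (r * (r - 1) div 2)) *
     (\<Sum>i\<le>r. (-1) ^ i * q ^ (i * (i - 1) div 2) * q_binom q r (int i) * q_int q (r - i) ^ k)"

function b_coeff :: "real \<Rightarrow> nat \<Rightarrow> nat \<Rightarrow> real" where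
  "b_coeff q j k =
     (if j = k then 1
      else if j = 0 \<and> k = 1 then 0
      else (\<Sum>i=j+1..k.
              (1 - q) ^ (i - j) * q_stirling q i j / (q ^ ((k - j) * (k + j - 1) div 2) - 1)
              * b_coeff q i k))"
  by pat_completeness auto
termination
  by (relation "Wellfounded.measure (\<lambda>(q, j, k). k - j)") auto

declare b_coeff.simps [simp del]

end

theory Submission
  imports Defs
begin

text \<open>
  The operator is triangular on the monomials, so its monic eigenvectors come from back
  substitution in an upper triangular matrix, and back substitution is a continuous function of
  that matrix as long as the relevant diagonal entries stay apart. It therefore suffices to
  compute the matrix of the operator and to take its limit entry by entry.

  The matrix becomes transparent in the falling q-factorials
  \<open>\<phi>\<^sub>r(i) = [i] [i - 1] \<cdots> [i - r + 1]\<close>. The classical q-Bernstein sum sends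
  \<open>\<phi>\<^sub>r\<close> to \<open>\<phi>\<^sub>r(n) x\<^sup>r\<close> (\<open>q_bernstein_sum_falling\<close>). The part with weight
  \<open>1 - \<alpha>\<close> is a q-Bernstein sum of order \<open>n - 2\<close> with a perturbation by the two-step difference
  \<open>f(i + 2) - f(i)\<close> (\<open>aq_bernstein_split\<close>), and differences of falling factorials are again
  combinations of falling factorials. Hence the operator sends \<open>\<phi>\<^sub>r\<close> to
  \<open>A x\<^sup>r + B x\<^bsup>r - 1\<^esup>\<close> with explicit \<open>A\<close> and \<open>B\<close>
  (\<open>aq_bernstein_falling\<close>). The q-Stirling numbers convert powers \<open>[i]\<^sup>m\<close> to falling factorials
  (\<open>q_int_power_eq_sum_falling\<close>), which gives the matrix \<open>aq_matrix\<close>; its diagonal consists of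
  the stated eigenvalues.

  As \<open>n\<close> grows, \<open>[n - c]\<close> tends to \<open>1 / (1 - q)\<close> and \<open>q\<^bsup>n - c\<^esup>\<close> to \<open>0\<close>.
  So \<open>B\<close> disappears, and the entry in row \<open>j\<close> and column \<open>i\<close> tends to
  \<open>(1 - q)\<^bsup>i - j\<^esup> S(i, j) q\<^bsup>j (j - 1) / 2\<^esup>\<close>. Back substitution in the limit matrix is
  the recursion for \<open>b_coeff\<close> after the common factor \<open>q\<^bsup>j (j - 1) / 2\<^esup>\<close> is cancelled.
  For \<open>k \<ge> 2\<close> its \<open>k\<close>-th diagonal entry \<open>q\<^bsup>k (k - 1) / 2\<^esup>\<close> is different from all earlier
  ones, so for all large \<open>n\<close> the eigenvector exists, is unique and is given by back substitution.
\<close>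

section \<open>q-integers and q-binomial coefficients\<close>

lemma q_int_0 [simp]: "q_int q 0 = 0"
  by (simp add: q_int_def)

lemma q_int_Suc: "q_int q (Suc m) = q_int q m + q ^ m"
  by (simp add: q_int_def)

lemma q_int_add: "q_int q (m + k) = q_int q m + q ^ m * q_int q k"
  by (induction k) (simp_all add: q_int_Suc power_add algebra_simps)

lemma q_int_pos: "0 < q \<Longrightarrow> 0 < m \<Longrightarrow> 0 < q_int q m"
  unfolding q_int_def by (intro sum_pos) auto

lemma q_int_nonzero: "0 < q \<Longrightarrow> 0 < m \<Longrightarrow> q_int q m \<noteq> 0"
  by (metis q_int_pos less_irrefl)

lemma q_fact_0 [simp]: "q_fact q 0 = 1"
  by (simp add: q_fact_def)

lemma q_fact_Suc: "q_fact q (Suc m) = q_int q (Suc m) * q_fact q m"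
  by (simp add: q_fact_def mult.commute)

lemma q_fact_nonzero: "0 < q \<Longrightarrow> q_fact q m \<noteq> 0"
  by (induction m) (simp_all add: q_fact_Suc q_int_nonzero)

text \<open>The q-binomial coefficient with a natural lower index, so that shifts of the summation
  index stay inside \<open>nat\<close>.\<close>
definition q_choose :: "real \<Rightarrow> nat \<Rightarrow> nat \<Rightarrow> real" where
  "q_choose q n k = (if k \<le> n then q_fact q n / (q_fact q k * q_fact q (n - k)) else 0)"

lemma q_binom_of_nat: "q_binom q n (int k) = q_choose q n k"
  by (simp add: q_binom_def q_choose_def)

lemma q_choose_eq_0: "n < k \<Longrightarrow> q_choose q n k = 0"
  by (simp add: q_choose_def)

lemma q_choose_0 [simp]: "0 < q \<Longrightarrow> q_choose q n 0 = 1"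
  by (simp add: q_choose_def q_fact_nonzero)

lemma q_choose_absorption:
  assumes "0 < q"
  shows "q_int q (Suc k) * q_choose q (Suc n) (Suc k) = q_int q (Suc n) * q_choose q n k"
  using assms q_int_nonzero[of q "Suc k"]
  by (simp add: q_choose_def q_fact_Suc q_fact_nonzero field_simps)

lemma q_choose_pascal:
  assumes "0 < q"
  shows "q_choose q (Suc n) (Suc k) = q_choose q n (Suc k) + q ^ (n - k) * q_choose q n k"
    and "q_choose q (Suc n) (Suc k) = q ^ Suc k * q_choose q n (Suc k) + q_choose q n k"
proof -
  have "q_choose q (Suc n) (Suc k) = q_choose q n (Suc k) + q ^ (n - k) * q_choose q n k \<and>
    q_choose q (Suc n) (Suc k) = q ^ Suc k * q_choose q n (Suc k) + q_choose q n k"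
  proof (cases "k < n")
    case True
    define d where "d = n - Suc k"
    have n: "n = k + Suc d" using True by (simp add: d_def)
    have nz: "q_int q (Suc k) \<noteq> 0" "q_int q (Suc d) \<noteq> 0" "q_fact q k \<noteq> 0" "q_fact q d \<noteq> 0"
      using assms by (auto simp: q_int_nonzero q_fact_nonzero)
    \<comment> \<open>All three coefficients are multiples of \<open>u\<close>, by \<open>[n + 1]\<close>, \<open>[n - k]\<close> and \<open>[k + 1]\<close>; the
      two recurrences are the two ways to split \<open>[n + 1]\<close> as \<open>[(n - k) + (k + 1)]\<close>.\<close>
    define u where "u = q_fact q n / (q_fact q (Suc k) * q_fact q (Suc d))"
    have c1: "q_choose q (Suc n) (Suc k) = q_int q (Suc n) * u"
      by (simp add: q_choose_def u_def n q_fact_Suc)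
    have c2: "q_choose q n (Suc k) = q_int q (Suc d) * u"
      using nz by (simp add: q_choose_def u_def n q_fact_Suc field_simps)
    have c3: "q_choose q n k = q_int q (Suc k) * u"
      using nz by (simp add: q_choose_def u_def n q_fact_Suc field_simps)
    have a: "q_int q (Suc n) = q_int q (Suc d) + q ^ (n - k) * q_int q (Suc k)"
      using q_int_add[of q "Suc d" "Suc k"] by (simp add: n add.commute)
    have b: "q_int q (Suc n) = q_int q (Suc k) + q ^ Suc k * q_int q (Suc d)"
      using q_int_add[of q "Suc k" "Suc d"] by (simp add: n)
    show ?thesis
      unfolding c1 c2 c3 using arg_cong[OF a, of "\<lambda>t. t * u"] arg_cong[OF b, of "\<lambda>t. t * u"]
      by (simp only: distrib_right mult.assoc) (intro conjI; linarith)
  next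
    case False
    then show ?thesis
      using assms by (cases "k = n") (auto simp: q_choose_def q_fact_nonzero)
  qed
  then show "q_choose q (Suc n) (Suc k) = q_choose q n (Suc k) + q ^ (n - k) * q_choose q n k"
    and "q_choose q (Suc n) (Suc k) = q ^ Suc k * q_choose q n (Suc k) + q_choose q n k"
    by auto
qed

section \<open>Falling q-factorials\<close>

text \<open>The product \<open>[n] [n - 1] \<cdots> [n - r + 1]\<close>. For \<open>r > n\<close> the truncated subtraction reaches
  the factor \<open>[0] = 0\<close>, so the value is \<open>0\<close>.\<close>
primrec q_falling :: "real \<Rightarrow> nat \<Rightarrow> nat \<Rightarrow> real" where
  "q_falling q n 0 = 1"
| "q_falling q n (Suc r) = q_int q n * q_falling q (n - 1) r"

lemma q_falling_eq_0: "n < r \<Longrightarrow> q_falling q n r = 0"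
proof (induction r arbitrary: n)
  case (Suc r)
  then show ?case by (cases n) simp_all
qed simp

lemma q_falling_Suc_right: "q_falling q n (Suc r) = q_falling q n r * q_int q (n - r)"
proof (induction r arbitrary: n)
  case (Suc r)
  have "q_falling q n (Suc (Suc r)) = q_int q n * q_falling q (n - 1) (Suc r)"
    by (rule q_falling.simps(2))
  also have "\<dots> = q_int q n * (q_falling q (n - 1) r * q_int q (n - 1 - r))"
    by (simp only: Suc.IH)
  also have "\<dots> = q_falling q n (Suc r) * q_int q (n - Suc r)"
    by simp
  finally show ?case .
qed simp

lemma q_fact_eq_q_falling: "r \<le> n \<Longrightarrow> q_fact q n = q_falling q n r * q_fact q (n - r)"
proof (induction r arbitrary: n)
  case (Suc r)
  then obtain m where "n = Suc m" by (cases n) auto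
  then show ?case using Suc by (simp add: q_fact_Suc)
qed simp

text \<open>The first factor of \<open>\<phi>\<^sub>r(l + 1)\<close> splits as
  \<open>[l + 1] = [r] + q\<^sup>r [l + 1 - r]\<close>, and \<open>[l + 1 - r]\<close> is the factor that extends
  \<open>\<phi>\<^bsub>r - 1\<^esub>(l)\<close> to \<open>\<phi>\<^sub>r(l)\<close>. For \<open>r = 0\<close> the first summand has the factor \<open>[0] = 0\<close>.\<close>
lemma q_falling_Suc_left:
  "q_falling q (Suc l) r = q_int q r * q_falling q l (r - 1) + q ^ r * q_falling q l r"
proof (cases r)
  case (Suc s)
  show ?thesis
  proof (cases "s \<le> l")
    case True
    then have "q_int q (Suc l) = q_int q (Suc s) + q ^ Suc s * q_int q (l - s)"
      using q_int_add[of q "Suc s" "l - s"] by simp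
    then have "q_falling q (Suc l) r = (q_int q (Suc s) + q ^ Suc s * q_int q (l - s)) * q_falling q l s"
      by (simp add: Suc)
    also have "\<dots> = q_int q (Suc s) * q_falling q l s + q ^ Suc s * q_falling q l (Suc s)"
      unfolding q_falling_Suc_right by (simp add: algebra_simps)
    finally show ?thesis by (simp add: Suc)
  next
    case False
    then show ?thesis by (simp add: Suc q_falling_eq_0 del: q_falling.simps(2))
  qed
qed simp

text \<open>The two values share the factor \<open>\<phi>\<^sub>s(l)\<close>, and \<open>[l + 1] - [l - s] = q\<^bsup>l - s\<^esup> [s + 1]\<close>.
  The weight \<open>q\<^bsup>N - l\<^esup>\<close>, which the operator supplies, turns the power of \<open>q\<close> into a
  constant, so that the difference operator maps falling factorials to multiples of
  falling factorials.\<close>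
lemma q_falling_diff:
  assumes "l \<le> N"
  shows "q ^ (N - l) * (q_falling q (Suc l) (Suc s) - q_falling q l (Suc s)) =
    q ^ (N - s) * q_int q (Suc s) * q_falling q l s"
proof (cases "s \<le> l")
  case True
  have "q_int q (Suc l) = q_int q (l - s) + q ^ (l - s) * q_int q (Suc s)"
    using q_int_add[of q "l - s" "Suc s"] True by simp
  then have "q_falling q (Suc l) (Suc s) - q_falling q l (Suc s) =
      q ^ (l - s) * q_int q (Suc s) * q_falling q l s"
    unfolding q_falling_Suc_right[of q l s] by (simp add: algebra_simps)
  moreover have "q ^ (N - s) = q ^ (N - l) * q ^ (l - s)"
    using True assms by (simp add: power_add[symmetric])
  ultimately show ?thesis by (simp add: algebra_simps)
next
  case False
  then show ?thesis by (simp add: q_falling_eq_0 del: q_falling.simps(2))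
qed

section \<open>The operator on falling q-factorials\<close>
definition q_bernstein_sum :: "real \<Rightarrow> nat \<Rightarrow> (nat \<Rightarrow> real) \<Rightarrow> real \<Rightarrow> real" where
  "q_bernstein_sum q n g x =
     (\<Sum>l\<le>n. g l * (q_choose q n l * x ^ l * q_pochhammer x q (n - l)))"

lemma q_pochhammer_0 [simp]: "q_pochhammer x q 0 = 1"
  by (simp add: q_pochhammer_def)

lemma q_pochhammer_Suc: "q_pochhammer x q (Suc k) = q_pochhammer x q k * (1 - x * q ^ k)"
  by (simp add: q_pochhammer_def)

text \<open>The weights form a partition of unity. By the first Pascal rule, the weight with index
  \<open>l\<close> of order \<open>n\<close> is divided in the proportions \<open>1 - q\<^bsup>n - l\<^esup> x\<close> and
  \<open>q\<^bsup>n - l\<^esup> x\<close> between the weights with indices \<open>l\<close> and \<open>l + 1\<close> of order \<open>n + 1\<close>, which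
  preserves the total.\<close>
lemma q_bernstein_sum_1:
  assumes "0 < q"
  shows "q_bernstein_sum q n (\<lambda>_. 1) x = 1"
proof (induction n)
  case 0
  then show ?case using assms by (simp add: q_bernstein_sum_def)
next
  case (Suc n)
  let ?w = "\<lambda>l. q_choose q n l * x ^ l * q_pochhammer x q (n - l)"
  have "q_bernstein_sum q (Suc n) (\<lambda>_. 1) x =
      q_pochhammer x q (Suc n)
      + (\<Sum>l\<le>n. q_choose q (Suc n) (Suc l) * x ^ Suc l * q_pochhammer x q (n - l))"
    using assms unfolding q_bernstein_sum_def by (subst sum.atMost_Suc_shift) simp
  also have "\<dots> = q_pochhammer x q (Suc n)
      + (\<Sum>l\<le>n. q_choose q n (Suc l) * x ^ Suc l * q_pochhammer x q (n - l))
      + (\<Sum>l\<le>n. x * q ^ (n - l) * ?w l)"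
    unfolding q_choose_pascal(1)[OF assms] by (simp add: sum.distrib algebra_simps)
  also have "q_pochhammer x q (Suc n)
      + (\<Sum>l\<le>n. q_choose q n (Suc l) * x ^ Suc l * q_pochhammer x q (n - l)) =
      (\<Sum>l\<le>Suc n. q_choose q n l * x ^ l * q_pochhammer x q (Suc n - l))"
    using assms by (subst sum.atMost_Suc_shift) simp
  also have "\<dots> = (\<Sum>l\<le>n. q_choose q n l * x ^ l * q_pochhammer x q (Suc n - l))"
    by (simp add: q_choose_eq_0)
  also have "\<dots> = (\<Sum>l\<le>n. (1 - x * q ^ (n - l)) * ?w l)"
    by (intro sum.cong) (auto simp: Suc_diff_le q_pochhammer_Suc)
  also have "\<dots> + (\<Sum>l\<le>n. x * q ^ (n - l) * ?w l) = (\<Sum>l\<le>n. ?w l)"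
    by (simp add: sum.distrib[symmetric] algebra_simps)
  also have "\<dots> = 1"
    using Suc by (simp add: q_bernstein_sum_def)
  finally show ?case .
qed

text \<open>Each factor of the falling factorial is absorbed by the q-binomial coefficient, which
  lowers the order of the sum by one and leaves a factor \<open>[n] x\<close>.\<close>
lemma q_bernstein_sum_falling:
  assumes "0 < q"
  shows "q_bernstein_sum q n (\<lambda>l. q_falling q l r) x = q_falling q n r * x ^ r"
proof (induction r arbitrary: n)
  case 0
  then show ?case using q_bernstein_sum_1[OF assms] by simp
next
  case (Suc r)
  show ?case
  proof (cases n)
    case 0
    then show ?thesis by (simp add: q_bernstein_sum_def)
  next
    case (Suc m)
    have "q_bernstein_sum q n (\<lambda>l. q_falling q l (Suc r)) x =
        (\<Sum>l\<le>m. q_falling q l r * (q_int q (Suc l) * q_choose q (Suc m) (Suc l))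
          * x ^ Suc l * q_pochhammer x q (m - l))"
      unfolding q_bernstein_sum_def Suc
      by (subst sum.atMost_Suc_shift) (simp add: mult_ac)
    also have "\<dots> = q_int q (Suc m) * x * q_bernstein_sum q m (\<lambda>l. q_falling q l r) x"
      unfolding q_choose_absorption[OF assms] q_bernstein_sum_def sum_distrib_left
      by (simp add: mult_ac)
    finally show ?thesis using Suc.IH Suc by (simp add: mult_ac)
  qed
qed

lemma q_bernstein_sum_add:
  "q_bernstein_sum q n (\<lambda>l. f l + g l) x = q_bernstein_sum q n f x + q_bernstein_sum q n g x"
  by (simp add: q_bernstein_sum_def distrib_right sum.distrib)

lemma q_bernstein_sum_scale:
  "q_bernstein_sum q n (\<lambda>l. c * g l) x = c * q_bernstein_sum q n g x"
  by (simp add: q_bernstein_sum_def sum_distrib_left mult.assoc)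

text \<open>In the first part of the basis, \<open>(x;q)\<close> has one factor \<open>1 - q\<^bsup>N - l\<^esup> x\<close> more than
  in the weights of order \<open>N\<close>; the second part, after the shift \<open>i = l + 2\<close>, carries
  \<open>q\<^bsup>N - l\<^esup> x\<close>. Together they average \<open>g l\<close> and \<open>g (l + 2)\<close> with these proportions.\<close>
lemma aq_bernstein_split:
  "(\<Sum>i\<le>N + 2. g i * poly (aq_basis q \<alpha> (N + 2) i) x) =
    (1 - \<alpha>) * (q_bernstein_sum q N g x
       + x * q_bernstein_sum q N (\<lambda>l. q ^ (N - l) * (g (l + 2) - g l)) x)
    + \<alpha> * q_bernstein_sum q (N + 2) g x"
proof -
  let ?w = "\<lambda>l. q_choose q N l * x ^ l * q_pochhammer x q (N - l)"
  have b: "poly (aq_basis q \<alpha> (N + 2) i) x =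
      (1 - \<alpha>) * (q_choose q N i * x ^ i * q_pochhammer x q (N + 1 - i))
    + (1 - \<alpha>) * (q_binom q N (int i - 2) * q ^ (N + 2 - i) * x ^ (i - 1) * q_pochhammer x q (N + 2 - i))
    + \<alpha> * (q_choose q (N + 2) i * x ^ i * q_pochhammer x q (N + 2 - i))" for i
    by (simp add: aq_basis_def poly_q_pochhammer poly_power q_binom_of_nat algebra_simps)
  have A: "(\<Sum>i\<le>N + 2. g i * (q_choose q N i * x ^ i * q_pochhammer x q (N + 1 - i))) =
      (\<Sum>l\<le>N. g l * (1 - x * q ^ (N - l)) * ?w l)"
  proof -
    have "(\<Sum>i\<le>N + 2. g i * (q_choose q N i * x ^ i * q_pochhammer x q (N + 1 - i))) =
        (\<Sum>l\<le>N. g l * (q_choose q N l * x ^ l * q_pochhammer x q (N + 1 - l)))"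
      by (simp add: q_choose_eq_0)
    also have "\<dots> = (\<Sum>l\<le>N. g l * (1 - x * q ^ (N - l)) * ?w l)"
      by (intro sum.cong) (auto simp: Suc_diff_le q_pochhammer_Suc)
    finally show ?thesis .
  qed
  have B: "(\<Sum>i\<le>N + 2. g i * (q_binom q N (int i - 2) * q ^ (N + 2 - i) * x ^ (i - 1)
        * q_pochhammer x q (N + 2 - i))) =
      (\<Sum>l\<le>N. x * g (l + 2) * q ^ (N - l) * ?w l)"
  proof -
    have "N + 2 = Suc (Suc N)" by simp
    moreover have "q_binom q N (- 2) = 0" "q_binom q N (- 1) = 0"
      by (auto simp: q_binom_def)
    ultimately show ?thesis
      by (simp only: sum.atMost_Suc_shift)
        (simp add: q_binom_of_nat mult_ac)
  qed
  have "(\<Sum>i\<le>N + 2. g i * poly (aq_basis q \<alpha> (N + 2) i) x) =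
      (1 - \<alpha>) * (\<Sum>i\<le>N + 2. g i * (q_choose q N i * x ^ i * q_pochhammer x q (N + 1 - i)))
    + (1 - \<alpha>) * (\<Sum>i\<le>N + 2. g i * (q_binom q N (int i - 2) * q ^ (N + 2 - i) * x ^ (i - 1)
        * q_pochhammer x q (N + 2 - i)))
    + \<alpha> * q_bernstein_sum q (N + 2) g x"
    unfolding b q_bernstein_sum_def sum_distrib_left
    by (simp only: sum.distrib distrib_left mult_ac)
  also have "\<dots> = (1 - \<alpha>) * (q_bernstein_sum q N g x
       + x * q_bernstein_sum q N (\<lambda>l. q ^ (N - l) * (g (l + 2) - g l)) x)
    + \<alpha> * q_bernstein_sum q (N + 2) g x"
    unfolding A B
    by (simp add: q_bernstein_sum_def sum_distrib_left sum.distrib[symmetric] algebra_simps)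
  finally show ?thesis .
qed

text \<open>The two coefficients that the operator of order \<open>n\<close> produces from the falling factorial
  \<open>\<phi>\<^sub>r\<close>: those of \<open>x\<^sup>r\<close> and of \<open>x\<^bsup>r - 1\<^esup>\<close>.\<close>
definition aq_lead :: "real \<Rightarrow> real \<Rightarrow> nat \<Rightarrow> nat \<Rightarrow> real" where
  "aq_lead q \<alpha> n r =
     (1 - \<alpha>) * (q_falling q (n - 2) r
        + q ^ (n - 1 - r) * q_int q r * (1 + q ^ r) * q_falling q (n - 2) (r - 1))
     + \<alpha> * q_falling q n r"

definition aq_sub :: "real \<Rightarrow> real \<Rightarrow> nat \<Rightarrow> nat \<Rightarrow> real" where
  "aq_sub q \<alpha> n r =
     (1 - \<alpha>) * q ^ (n - r) * q_int q r * q_int q (r - 1) * q_falling q (n - 2) (r - 2)"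

lemma aq_bernstein_falling:
  assumes "0 < q" "r + 2 \<le> n"
  shows "(\<Sum>i\<le>n. q_falling q i r * poly (aq_basis q \<alpha> n i) x) =
    aq_lead q \<alpha> n r * x ^ r + aq_sub q \<alpha> n r * x ^ (r - 1)"
proof -
  define N where "N = n - 2"
  have n: "n = N + 2" and rN: "r \<le> N" using assms(2) by (auto simp: N_def)
  show ?thesis
  proof (cases r)
    case 0
    have "q_bernstein_sum q N (\<lambda>l. 0) x = 0" by (simp add: q_bernstein_sum_def)
    then show ?thesis
      unfolding n aq_bernstein_split
      by (simp add: 0 q_bernstein_sum_1[OF assms(1)] aq_lead_def aq_sub_def algebra_simps)
  next
    case (Suc s)
    \<comment> \<open>The two-step difference is a sum of two one-step differences. The shifted value
      \<open>\<phi>\<^sub>s(l + 1)\<close> that remains from the first of them produces the term of lower degree.\<close>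
    have step: "q ^ (N - l) * (q_falling q (l + 2) r - q_falling q l r) =
        (q ^ (N - s) * q_int q r * (1 + q ^ r)) * q_falling q l s +
        (q ^ (N + 1 - s) * q_int q r * q_int q s) * q_falling q l (s - 1)" if "l \<le> N" for l
    proof -
      have "q ^ (N - l) * (q_falling q (l + 2) r - q_falling q l r) =
          q ^ (Suc N - Suc l) * (q_falling q (Suc (Suc l)) (Suc s) - q_falling q (Suc l) (Suc s))
        + q ^ (N - l) * (q_falling q (Suc l) (Suc s) - q_falling q l (Suc s))"
        by (simp add: Suc algebra_simps del: q_falling.simps(2))
      also have "\<dots> = q ^ (Suc N - s) * q_int q r * q_falling q (Suc l) s
          + q ^ (N - s) * q_int q r * q_falling q l s"
        using that by (simp only: q_falling_diff Suc_le_mono Suc)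
      also have "q ^ (Suc N - s) * q_int q r * q_falling q (Suc l) s
          = q ^ (N + 1 - s) * q_int q r * q_int q s * q_falling q l (s - 1)
          + q ^ (N - s) * q_int q r * q ^ r * q_falling q l s"
        using rN by (simp add: q_falling_Suc_left Suc Suc_diff_le algebra_simps)
      finally show ?thesis by (simp add: algebra_simps)
    qed
    have "q_bernstein_sum q N (\<lambda>l. q ^ (N - l) * (q_falling q (l + 2) r - q_falling q l r)) x =
        q_bernstein_sum q N (\<lambda>l. (q ^ (N - s) * q_int q r * (1 + q ^ r)) * q_falling q l s +
        (q ^ (N + 1 - s) * q_int q r * q_int q s) * q_falling q l (s - 1)) x"
      unfolding q_bernstein_sum_def by (intro sum.cong) (auto simp only: step atMost_iff)
    also have "\<dots> = (q ^ (N - s) * q_int q r * (1 + q ^ r)) * (q_falling q N s * x ^ s) +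
        (q ^ (N + 1 - s) * q_int q r * q_int q s) * (q_falling q N (s - 1) * x ^ (s - 1))"
      by (simp only: q_bernstein_sum_add q_bernstein_sum_scale q_bernstein_sum_falling[OF assms(1)])
    finally have E: "q_bernstein_sum q N
          (\<lambda>l. q ^ (N - l) * (q_falling q (l + 2) r - q_falling q l r)) x = \<dots>" .
    show ?thesis
      unfolding n aq_bernstein_split E q_bernstein_sum_falling[OF assms(1)]
      by (cases s) (simp_all add: aq_lead_def aq_sub_def Suc algebra_simps del: q_falling.simps(2))
  qed
qed

section \<open>q-Stirling numbers and powers of q-integers\<close>
lemma triangular_Suc: "Suc r * r div 2 = r * (r - 1) div 2 + r"
proof (cases r)
  case (Suc s)
  have "Suc r * r = r * (r - 1) + r * 2" by (simp add: Suc algebra_simps)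
  then show ?thesis by simp
qed simp

text \<open>For \<open>r > 0\<close> the alternating sum telescopes by the second Pascal rule.\<close>
lemma q_stirling_0: 
  assumes "0 < q"
  shows "q_stirling q 0 r = (if r = 0 then 1 else 0)"
proof (cases r)
  case 0
  then show ?thesis using assms by (simp add: q_stirling_def q_binom_def)
next
  case (Suc s)
  define u where "u i = (-1) ^ i * q ^ (Suc i * i div 2) * q_choose q s i" for i
  have "(\<Sum>i\<le>r. (-1) ^ i * q ^ (i * (i - 1) div 2) * q_choose q r i) =
      1 + (\<Sum>i\<le>s. (-1) ^ Suc i * q ^ (Suc i * i div 2) * q_choose q (Suc s) (Suc i))"
    unfolding Suc using assms by (subst sum.atMost_Suc_shift) simp
  also have "\<dots> = 1 + (\<Sum>i\<le>s. u (Suc i) - u i)"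
  proof -
    have "(-1) ^ Suc i * q ^ (Suc i * i div 2) * q_choose q (Suc s) (Suc i) = u (Suc i) - u i" for i
      unfolding q_choose_pascal(2)[OF assms] u_def
        triangular_Suc[of "Suc i"]
      by (simp add: power_add algebra_simps)
    then show ?thesis by simp
  qed
  also have "\<dots> = 1 + (u (Suc s) - u 0)"
    by (subst sum_lessThan_telescope[symmetric]) (simp add: lessThan_Suc_atMost)
  also have "\<dots> = 0"
    using assms by (simp add: u_def q_choose_eq_0)
  finally show ?thesis
    unfolding q_stirling_def by (simp add: Suc q_binom_of_nat del: of_nat_Suc)
qed

lemma q_stirling_Suc_0: "0 < q \<Longrightarrow> q_stirling q (Suc k) 0 = 0"
  by (simp add: q_stirling_def)

text \<open>In the alternating sum \<open>D\<close> of the definition, one more factor \<open>[r + 1 - i]\<close> equals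
  \<open>[r + 1] - q\<^bsup>r + 1 - i\<^esup> [i]\<close>. The first term gives the same sum again; in the second,
  \<open>[i]\<close> is absorbed by the q-binomial coefficient, which leaves the sum for \<open>r\<close>.\<close>
lemma q_stirling_Suc_Suc:
  assumes "0 < q"
  shows "q_stirling q (Suc k) (Suc r) = q_int q (Suc r) * q_stirling q k (Suc r) + q_stirling q k r"
proof -
  define D where "D r k = (\<Sum>i\<le>r. (-1) ^ i * q ^ (i * (i - 1) div 2) * q_choose q r i
      * q_int q (r - i) ^ k)" for r k
  have S: "q_stirling q k r = D r k / (q_fact q r * q ^ (r * (r - 1) div 2))" for k r
    by (simp add: q_stirling_def D_def q_binom_of_nat)
  have "q_int q (Suc r) * D (Suc r) k - D (Suc r) (Suc k) =
      (\<Sum>i\<le>Suc r. (-1) ^ i * q ^ (i * (i - 1) div 2) * q_choose q (Suc r) i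
        * q_int q (Suc r - i) ^ k * (q ^ (Suc r - i) * q_int q i))"
    unfolding D_def sum_distrib_left sum_subtractf[symmetric]
  proof (intro sum.cong refl)
    fix i assume "i \<in> {..Suc r}"
    then have d: "q_int q (Suc r) = q_int q (Suc r - i) + q ^ (Suc r - i) * q_int q i"
      using q_int_add[of q "Suc r - i" i] by simp
    show "q_int q (Suc r) * ((-1) ^ i * q ^ (i * (i - 1) div 2) * q_choose q (Suc r) i
          * q_int q (Suc r - i) ^ k)
        - (-1) ^ i * q ^ (i * (i - 1) div 2) * q_choose q (Suc r) i * q_int q (Suc r - i) ^ Suc k =
        (-1) ^ i * q ^ (i * (i - 1) div 2) * q_choose q (Suc r) i
          * q_int q (Suc r - i) ^ k * (q ^ (Suc r - i) * q_int q i)"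
      unfolding d by (simp add: algebra_simps)
  qed
  also have "\<dots> = (\<Sum>i\<le>r. (-1) ^ Suc i * q ^ (Suc i * i div 2)
        * (q_int q (Suc i) * q_choose q (Suc r) (Suc i))
        * q_int q (r - i) ^ k * q ^ (r - i))"
    by (subst sum.atMost_Suc_shift) (simp add: mult_ac)
  also have "\<dots> = (\<Sum>i\<le>r. - q_int q (Suc r) * q ^ r * ((-1) ^ i * q ^ (i * (i - 1) div 2)
        * q_choose q r i * q_int q (r - i) ^ k))"
  proof (intro sum.cong refl)
    fix i assume "i \<in> {..r}"
    then have "q ^ r = q ^ i * q ^ (r - i)" by (simp add: power_add[symmetric])
    then show "(-1) ^ Suc i * q ^ (Suc i * i div 2)
        * (q_int q (Suc i) * q_choose q (Suc r) (Suc i)) * q_int q (r - i) ^ k * q ^ (r - i) =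
       - q_int q (Suc r) * q ^ r * ((-1) ^ i * q ^ (i * (i - 1) div 2)
        * q_choose q r i * q_int q (r - i) ^ k)"
      unfolding q_choose_absorption[OF assms] triangular_Suc by (simp add: power_add)
  qed
  also have "\<dots> = - q_int q (Suc r) * q ^ r * D r k"
    unfolding D_def sum_distrib_left ..
  finally have "D (Suc r) (Suc k) = q_int q (Suc r) * D (Suc r) k + q_int q (Suc r) * q ^ r * D r k"
    by simp
  then show ?thesis
    unfolding S q_fact_Suc diff_Suc_1 triangular_Suc power_add
    using assms q_int_nonzero[of q "Suc r"] q_fact_nonzero[of q r]
    by (simp add: field_simps)
qed

lemma q_stirling_eq_0: "0 < q \<Longrightarrow> k < r \<Longrightarrow> q_stirling q k r = 0"
proof (induction k arbitrary: r)
  case (Suc k)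
  then obtain s where "r = Suc s" by (cases r) auto
  then show ?case using Suc by (simp add: q_stirling_Suc_Suc)
qed (simp add: q_stirling_0)

lemma q_stirling_same: "0 < q \<Longrightarrow> q_stirling q k k = 1"
  by (induction k) (simp_all add: q_stirling_0 q_stirling_Suc_Suc q_stirling_eq_0)

text \<open>The q-Stirling numbers are the connection coefficients between powers and falling
  factorials: multiplication by \<open>[i] = [r] + q\<^sup>r [i - r]\<close> on falling factorials reproduces
  their recurrence.\<close>
lemma q_int_power_eq_sum_falling:
  assumes "0 < q"
  shows "q_int q i ^ m = (\<Sum>r\<le>m. q_stirling q m r * q ^ (r * (r - 1) div 2) * q_falling q i r)"
proof (induction m)
  case 0
  then show ?case using assms by (simp add: q_stirling_0)
next
  case (Suc m)
  let ?c = "\<lambda>r. q ^ (r * (r - 1) div 2)"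
  have step: "q_int q i * q_falling q i r = q_int q r * q_falling q i r + q ^ r * q_falling q i (Suc r)" for r
  proof (cases "r \<le> i")
    case True
    then show ?thesis
      using q_int_add[of q r "i - r"] unfolding q_falling_Suc_right by (simp add: algebra_simps)
  qed (simp add: q_falling_eq_0 del: q_falling.simps(2))
  have "q_int q i ^ Suc m = (\<Sum>r\<le>m. q_stirling q m r * ?c r * (q_int q i * q_falling q i r))"
    by (simp add: Suc sum_distrib_left mult_ac)
  also have "\<dots> = (\<Sum>r\<le>m. q_int q r * q_stirling q m r * ?c r * q_falling q i r)
      + (\<Sum>r\<le>m. q_stirling q m r * ?c (Suc r) * q_falling q i (Suc r))"
    unfolding step diff_Suc_1 triangular_Suc power_add
    by (simp add: sum.distrib[symmetric] algebra_simps del: q_falling.simps(2))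
  also have "(\<Sum>r\<le>m. q_int q r * q_stirling q m r * ?c r * q_falling q i r) =
      (\<Sum>r\<le>Suc m. q_int q r * q_stirling q m r * ?c r * q_falling q i r)"
    using assms by (simp add: q_stirling_eq_0)
  also have "\<dots> = (\<Sum>r\<le>m. q_int q (Suc r) * q_stirling q m (Suc r) * ?c (Suc r) * q_falling q i (Suc r))"
    by (subst sum.atMost_Suc_shift) simp
  also have "\<dots> + (\<Sum>r\<le>m. q_stirling q m r * ?c (Suc r) * q_falling q i (Suc r)) =
      (\<Sum>r\<le>m. q_stirling q (Suc m) (Suc r) * ?c (Suc r) * q_falling q i (Suc r))"
    unfolding q_stirling_Suc_Suc[OF assms] sum.distrib[symmetric] distrib_right ..
  also have "\<dots> = (\<Sum>r\<le>Suc m. q_stirling q (Suc m) r * ?c r * q_falling q i r)"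
    using assms by (subst sum.atMost_Suc_shift) (simp add: q_stirling_Suc_0)
  finally show ?case .
qed

section \<open>The matrix of the operator on monomials\<close>

text \<open>The coefficient of \<open>x\<^sup>j\<close> in the image of \<open>t\<^sup>m\<close>, for large \<open>n\<close>. It receives the leading
  term of the falling factorial of order \<open>j\<close> and the lower term of the one of order
  \<open>j + 1\<close>.\<close>
definition aq_matrix :: "real \<Rightarrow> real \<Rightarrow> nat \<Rightarrow> nat \<Rightarrow> nat \<Rightarrow> real" where
  "aq_matrix q \<alpha> n j m =
     (q_stirling q m j * q ^ (j * (j - 1) div 2) * aq_lead q \<alpha> n j
      + q_stirling q m (Suc j) * q ^ (Suc j * j div 2) * aq_sub q \<alpha> n (Suc j)) / q_int q n ^ m"

lemma aq_matrix_lower: "0 < q \<Longrightarrow> m < j \<Longrightarrow> aq_matrix q \<alpha> n j m = 0"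
  by (simp add: aq_matrix_def q_stirling_eq_0)

lemma aq_bernstein_power:
  assumes "0 < q" "m + 2 \<le> n"
  shows "(\<Sum>i\<le>n. (q_int q i / q_int q n) ^ m * poly (aq_basis q \<alpha> n i) x) =
    (\<Sum>j\<le>m. aq_matrix q \<alpha> n j m * x ^ j)"
proof -
  let ?s = "\<lambda>r. q_stirling q m r * q ^ (r * (r - 1) div 2)"
  have "(\<Sum>i\<le>n. q_int q i ^ m * poly (aq_basis q \<alpha> n i) x) =
      (\<Sum>r\<le>m. ?s r * (\<Sum>i\<le>n. q_falling q i r * poly (aq_basis q \<alpha> n i) x))"
    unfolding q_int_power_eq_sum_falling[OF assms(1)] sum_distrib_left sum_distrib_right
    by (subst sum.swap) (simp add: mult_ac)
  also have "\<dots> = (\<Sum>r\<le>m. ?s r * (aq_lead q \<alpha> n r * x ^ r + aq_sub q \<alpha> n r * x ^ (r - 1)))"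
    using assms by (intro sum.cong) (simp_all add: aq_bernstein_falling)
  also have "\<dots> = (\<Sum>r\<le>m. ?s r * aq_lead q \<alpha> n r * x ^ r) + (\<Sum>r\<le>m. ?s r * aq_sub q \<alpha> n r * x ^ (r - 1))"
    by (simp add: sum.distrib[symmetric] algebra_simps)
  also have "(\<Sum>r\<le>m. ?s r * aq_sub q \<alpha> n r * x ^ (r - 1)) =
      (\<Sum>r\<le>Suc m. ?s r * aq_sub q \<alpha> n r * x ^ (r - 1))"
    using assms by (simp add: q_stirling_eq_0)
  also have "\<dots> = (\<Sum>j\<le>m. ?s (Suc j) * aq_sub q \<alpha> n (Suc j) * x ^ j)"
    by (subst sum.atMost_Suc_shift) (simp add: aq_sub_def)
  also have "(\<Sum>r\<le>m. ?s r * aq_lead q \<alpha> n r * x ^ r) + \<dots> =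
      (\<Sum>j\<le>m. aq_matrix q \<alpha> n j m * x ^ j) * q_int q n ^ m"
    using assms q_int_nonzero[of q n]
    unfolding sum_distrib_right sum.distrib[symmetric]
    by (intro sum.cong) (auto simp: aq_matrix_def field_simps)
  finally show ?thesis
    using assms q_int_nonzero[of q n]
    by (simp add: power_divide sum_divide_distrib[symmetric] field_simps)
qed

lemma coeff_sum_monom:
  "coeff (\<Sum>j\<le>k. monom (c j) j) i = (if i \<le> k then c i else 0)"
  by (simp add: coeff_sum)

lemma coeff_aq_bernstein:
  assumes "0 < q" "k + 2 \<le> n" "degree p \<le> k"
  shows "coeff (aq_bernstein q \<alpha> n (poly p)) j =
    (if j \<le> k then \<Sum>i=j..k. coeff p i * aq_matrix q \<alpha> n j i else 0)"
proof -
  have "poly (aq_bernstein q \<alpha> n (poly p)) x =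
      poly (\<Sum>j\<le>k. monom (\<Sum>i=j..k. coeff p i * aq_matrix q \<alpha> n j i) j) x" for x
  proof -
    have p: "poly p y = (\<Sum>i\<le>k. coeff p i * y ^ i)" for y
      unfolding poly_altdef using assms(3)
      by (intro sum.mono_neutral_left) (auto simp: coeff_eq_0)
    have "poly (aq_bernstein q \<alpha> n (poly p)) x =
        (\<Sum>i\<le>k. coeff p i * (\<Sum>l\<le>n. (q_int q l / q_int q n) ^ i * poly (aq_basis q \<alpha> n l) x))"
      unfolding aq_bernstein_def poly_sum poly_smult p sum_distrib_left sum_distrib_right
      by (subst sum.swap) (simp add: mult_ac)
    also have "\<dots> = (\<Sum>i\<le>k. coeff p i * (\<Sum>j\<le>i. aq_matrix q \<alpha> n j i * x ^ j))"
      using assms by (intro sum.cong) (simp_all add: aq_bernstein_power)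
    also have "\<dots> = (\<Sum>i\<le>k. \<Sum>j\<le>k. coeff p i * aq_matrix q \<alpha> n j i * x ^ j)"
      unfolding sum_distrib_left mult.assoc
      by (intro sum.cong sum.mono_neutral_left refl) (auto simp: aq_matrix_lower[OF assms(1)])
    also have "\<dots> = (\<Sum>j\<le>k. (\<Sum>i\<le>k. coeff p i * aq_matrix q \<alpha> n j i) * x ^ j)"
      unfolding sum_distrib_right by (rule sum.swap)
    also have "\<dots> = (\<Sum>j\<le>k. (\<Sum>i=j..k. coeff p i * aq_matrix q \<alpha> n j i) * x ^ j)"
      by (intro sum.cong refl arg_cong[where f = "\<lambda>s. s * _"] sum.mono_neutral_right)
        (auto simp: aq_matrix_lower[OF assms(1)])
    finally show ?thesis by (simp add: poly_sum poly_monom)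
  qed
  then have "aq_bernstein q \<alpha> n (poly p) =
      (\<Sum>j\<le>k. monom (\<Sum>i=j..k. coeff p i * aq_matrix q \<alpha> n j i) j)"
    by (intro poly_eq_poly_eq_iff[THEN iffD1] ext)
  then show ?thesis by (simp only: coeff_sum_monom)
qed

text \<open>With the common factor \<open>\<phi>\<^bsub>k - 2\<^esub>(n - 2) = [n - 2]! / [n - k]!\<close> taken out, the claim
  is \<open>[n - 1 - k] + q\<^bsup>n - 1 - k\<^esup> [k] (1 + q\<^sup>k) = [n - 1 + k]\<close>.\<close>
lemma aq_matrix_diag:
  assumes "0 < q" "2 \<le> k" "k + 2 \<le> n"
  shows "aq_matrix q \<alpha> n k k = aq_eigenvalue q \<alpha> n k"
proof -
  obtain s where k: "k = s + 2" using assms(2) by (metis le_add_diff_inverse2)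
  define d where "d = n - 2 - k"
  have n: "n = s + d + 4" using assms by (simp add: d_def k)
  let ?F = "q_falling q (n - 2) s"
  have f1: "q_falling q (n - 2) (k - 1) = ?F * q_int q (n - k)"
    unfolding k n using q_falling_Suc_right[of q "s + d + 2" s]
    by (simp add: add.commute eval_nat_numeral del: q_falling.simps(2))
  have f2: "q_falling q (n - 2) k = ?F * q_int q (n - k) * q_int q (n - 1 - k)"
    unfolding f1[symmetric] using q_falling_Suc_right[of q "n - 2" "k - 1"]
    by (simp add: k n del: q_falling.simps(2))
  have f3: "q_falling q n k = q_int q n * q_int q (n - 1) * ?F"
    by (simp add: k n numeral_2_eq_2)
  have "q_fact q (n - 2) = ?F * q_fact q (n - 2 - s)"
    by (rule q_fact_eq_q_falling) (simp add: n)
  moreover have "n - 2 - s = n - k" by (simp add: k)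
  ultimately have f4: "q_fact q (n - 2) / q_fact q (n - k) = ?F"
    using q_fact_nonzero[OF assms(1)] by simp
  have "n - 1 + k = (n - 1 - k) + (k + k)" using assms by simp
  then have i: "q_int q (n - 1 + k) = q_int q (n - 1 - k) + q ^ (n - 1 - k) * q_int q k * (1 + q ^ k)"
    by (simp only: q_int_add) (simp add: algebra_simps)
  have "aq_lead q \<alpha> n k = ?F * ((1 - \<alpha>) * q_int q (n - k) * q_int q (n - 1 + k)
      + \<alpha> * q_int q n * q_int q (n - 1))"
    unfolding aq_lead_def f1 f2 f3 i by (simp add: algebra_simps)
  then show ?thesis
    using assms(1,2) unfolding aq_matrix_def aq_eigenvalue_def
    by (simp add: q_stirling_same q_stirling_eq_0 f4[symmetric] divide_simps)
qed

section \<open>Eigenvectors of triangular matrices\<close>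

text \<open>The \<open>j\<close>-th coordinate of the eigenvector of the upper triangular matrix \<open>M\<close> for the
  eigenvalue \<open>M k k\<close>, with \<open>k\<close>-th coordinate \<open>1\<close>. The value \<open>1\<close> for \<open>j > k\<close> is a default.\<close>
function back_subst :: "(nat \<Rightarrow> nat \<Rightarrow> real) \<Rightarrow> nat \<Rightarrow> nat \<Rightarrow> real" where
  "back_subst M k j =
     (if k \<le> j then 1
      else (\<Sum>i=j+1..k. M j i * back_subst M k i) / (M k k - M j j))"
  by pat_completeness auto
termination
  by (relation "Wellfounded.measure (\<lambda>(M, k, j). k - j)") auto

declare back_subst.simps [simp del]

lemma back_subst_iff:
  assumes "\<And>j. j < k \<Longrightarrow> M k k \<noteq> M j j" and "c k = 1"
  shows "(\<forall>j\<le>k. (\<Sum>i=j..k. c i * M j i) = M k k * c j) \<longleftrightarrow> (\<forall>j\<le>k. c j = back_subst M k j)"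
proof -
  have row: "(\<Sum>i=j..k. c i * M j i) = M k k * c j \<longleftrightarrow>
      c j = (\<Sum>i=j+1..k. M j i * c i) / (M k k - M j j)" if "j < k" for j
  proof -
    have "(\<Sum>i=j..k. c i * M j i) = c j * M j j + (\<Sum>i=j+1..k. M j i * c i)"
      using that by (simp add: sum.atLeast_Suc_atMost mult.commute)
    then show ?thesis using assms(1)[OF that] by (auto simp: field_simps)
  qed
  show ?thesis
  proof
    assume L: "\<forall>j\<le>k. (\<Sum>i=j..k. c i * M j i) = M k k * c j"
    have "c j = back_subst M k j" if "j \<le> k" for j
      using that
    proof (induction "k - j" arbitrary: j rule: less_induct)
      case less
      show ?case
      proof (cases "j < k")
        case True
        have "c i = back_subst M k i" if "i \<in> {j+1..k}" for i
          using that True by (intro less.hyps) auto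
        then have "(\<Sum>i=j+1..k. M j i * c i) = (\<Sum>i=j+1..k. M j i * back_subst M k i)"
          by simp
        then show ?thesis
          using True L row[OF True] by (subst back_subst.simps) simp
      qed (use less.prems assms(2) in \<open>simp add: back_subst.simps\<close>)
    qed
    then show "\<forall>j\<le>k. c j = back_subst M k j" by blast
  next
    assume R: "\<forall>j\<le>k. c j = back_subst M k j"
    have "(\<Sum>i=j..k. c i * M j i) = M k k * c j" if "j \<le> k" for j
    proof (cases "j < k")
      case True
      have "(\<Sum>i=j+1..k. M j i * c i) = (\<Sum>i=j+1..k. M j i * back_subst M k i)"
        by (intro sum.cong) (simp_all add: R)
      then show ?thesis
        using True R by (subst row[OF True]) (simp add: back_subst.simps[of M k j])
    qed (use that assms(2) in simp)
    then show "\<forall>j\<le>k. (\<Sum>i=j..k. c i * M j i) = M k k * c j" by blast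
  qed
qed

text \<open>The coordinates are rational functions of the matrix entries whose denominators do not
  vanish at the limit.\<close>
lemma tendsto_back_subst:
  assumes M: "\<And>j i. ((\<lambda>n. M n j i) \<longlongrightarrow> M' j i) F"
    and "\<And>j. j < k \<Longrightarrow> M' k k \<noteq> M' j j"
  shows "((\<lambda>n. back_subst (M n) k j) \<longlongrightarrow> back_subst M' k j) F"
proof (induction "k - j" arbitrary: j rule: less_induct)
  case less
  show ?case
  proof (cases "k \<le> j")
    case True
    then show ?thesis by (simp add: back_subst.simps)
  next
    case False
    have "((\<lambda>n. (\<Sum>i=j+1..k. M n j i * back_subst (M n) k i) / (M n k k - M n j j)) \<longlongrightarrow>
        (\<Sum>i=j+1..k. M' j i * back_subst M' k i) / (M' k k - M' j j)) F"
      using assms(2)[of j] False by (intro tendsto_intros M less.hyps) auto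
    then show ?thesis
      using False by (simp add: back_subst.simps[of _ k j])
  qed
qed

lemma aq_eigenvector_eq:
  assumes "0 < q" "2 \<le> k" "k + 2 \<le> n"
    and "\<And>j. j < k \<Longrightarrow> aq_matrix q \<alpha> n k k \<noteq> aq_matrix q \<alpha> n j j"
  shows "aq_eigenvector q \<alpha> n k = (\<Sum>j\<le>k. monom (back_subst (aq_matrix q \<alpha> n) k j) j)"
    (is "_ = ?P")
proof -
  let ?M = "aq_matrix q \<alpha> n"
  have cP: "coeff ?P j = (if j \<le> k then back_subst ?M k j else 0)" for j
    by (rule coeff_sum_monom)
  have bk: "back_subst ?M k k = 1" by (simp add: back_subst.simps)
  have dP: "degree ?P = k"
    by (intro antisym degree_le le_degree) (auto simp: cP bk)
  \<comment> \<open>Comparison of coefficients turns the eigenvector equation into the triangular system,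
    so the operator has exactly one monic eigenvector of degree \<open>k\<close> for this eigenvalue.\<close>
  have eig: "aq_bernstein q \<alpha> n (poly p) = smult (aq_eigenvalue q \<alpha> n k) p \<longleftrightarrow> p = ?P"
    if "degree p = k" "lead_coeff p = 1" for p
  proof -
    have "aq_bernstein q \<alpha> n (poly p) = smult (aq_eigenvalue q \<alpha> n k) p \<longleftrightarrow>
        (\<forall>j\<le>k. (\<Sum>i=j..k. coeff p i * ?M j i) = ?M k k * coeff p j)"
      using that assms(1-3)
      by (auto simp: poly_eq_iff coeff_aq_bernstein[where k = k] aq_matrix_diag coeff_eq_0)
    also have "\<dots> \<longleftrightarrow> (\<forall>j\<le>k. coeff p j = back_subst ?M k j)"
      using that by (intro back_subst_iff assms(4)) auto
    also have "\<dots> \<longleftrightarrow> p = ?P"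
      using that by (auto simp: poly_eq_iff cP coeff_eq_0)
    finally show ?thesis .
  qed
  have "(THE p. degree p = k \<and> lead_coeff p = 1 \<and>
      aq_bernstein q \<alpha> n (poly p) = smult (aq_eigenvalue q \<alpha> n k) p) = ?P"
    using eig dP by (intro the_equality) (auto simp: cP bk)
  then show ?thesis using assms(2) by (simp add: aq_eigenvector_def)
qed

section \<open>The limit of large order\<close>
definition limit_matrix :: "real \<Rightarrow> nat \<Rightarrow> nat \<Rightarrow> real" where
  "limit_matrix q j i = (1 - q) ^ (i - j) * q_stirling q i j * q ^ (j * (j - 1) div 2)"

lemma q_int_closed: "q \<noteq> 1 \<Longrightarrow> q_int q n = (1 - q ^ n) / (1 - q)"
  by (simp add: q_int_def sum_gp_strict)

lemma tendsto_power_diff: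
  fixes q :: real
  assumes "0 < q" "q < 1"
  shows "(\<lambda>n. q ^ (n - c)) \<longlonglongrightarrow> 0"
  by (rule filterlim_compose[OF LIMSEQ_power_zero filterlim_minus_const_nat_at_top]) (use assms in auto)

lemma tendsto_q_int:
  assumes "0 < q" "q < 1"
  shows "(\<lambda>n. q_int q (n - c)) \<longlonglongrightarrow> 1 / (1 - q)"
proof -
  have "(\<lambda>n. (1 - q ^ (n - c)) / (1 - q)) \<longlonglongrightarrow> (1 - 0) / (1 - q)"
    using assms by (intro tendsto_intros tendsto_power_diff) auto
  then show ?thesis using assms by (simp add: q_int_closed)
qed

lemma tendsto_q_falling:
  assumes "0 < q" "q < 1"
  shows "(\<lambda>n. q_falling q (n - c) r) \<longlonglongrightarrow> (1 / (1 - q)) ^ r"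
proof (induction r arbitrary: c)
  case (Suc r)
  have "(\<lambda>n. q_int q (n - c) * q_falling q (n - (c + 1)) r) \<longlonglongrightarrow> 1 / (1 - q) * (1 / (1 - q)) ^ r"
    by (intro tendsto_mult tendsto_q_int[OF assms] Suc)
  then show ?case by simp
qed simp

text \<open>The lower term carries a factor \<open>q\<^bsup>n - c\<^esup>\<close> and disappears. The leading term behaves
  like \<open>[n]\<^sup>j\<close> for every value of \<open>\<alpha>\<close>, which is why the limit does not depend on \<open>\<alpha>\<close>.\<close>
lemma tendsto_aq_matrix:
  assumes "0 < q" "q < 1"
  shows "(\<lambda>n. aq_matrix q \<alpha> n j i) \<longlonglongrightarrow> limit_matrix q j i"
proof (cases "j \<le> i")
  case True
  let ?L = "1 / (1 - q)"
  have "(\<lambda>n. aq_lead q \<alpha> n j) \<longlonglongrightarrow>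
      (1 - \<alpha>) * (?L ^ j + 0 * q_int q j * (1 + q ^ j) * ?L ^ (j - 1)) + \<alpha> * ?L ^ j"
    unfolding aq_lead_def diff_diff_left
    using tendsto_q_falling[OF assms, of 0]
    by (intro tendsto_intros tendsto_q_falling tendsto_power_diff assms) simp
  then have lead: "(\<lambda>n. aq_lead q \<alpha> n j) \<longlonglongrightarrow> ?L ^ j"
    by (simp add: algebra_simps)
  have "(\<lambda>n. aq_sub q \<alpha> n (Suc j)) \<longlonglongrightarrow>
      (1 - \<alpha>) * 0 * q_int q (Suc j) * q_int q (Suc j - 1) * ?L ^ (Suc j - 2)"
    unfolding aq_sub_def
    by (intro tendsto_intros tendsto_q_falling tendsto_power_diff assms)
  then have sub: "(\<lambda>n. aq_sub q \<alpha> n (Suc j)) \<longlonglongrightarrow> 0" by simp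
  have int: "(\<lambda>n. q_int q n) \<longlonglongrightarrow> ?L"
    using tendsto_q_int[OF assms, of 0] by simp
  have "(\<lambda>n. aq_matrix q \<alpha> n j i) \<longlonglongrightarrow>
      (q_stirling q i j * q ^ (j * (j - 1) div 2) * ?L ^ j
        + q_stirling q i (Suc j) * q ^ (Suc j * j div 2) * 0) / ?L ^ i"
    unfolding aq_matrix_def using assms by (intro tendsto_intros lead sub int) auto
  also have "(q_stirling q i j * q ^ (j * (j - 1) div 2) * ?L ^ j
        + q_stirling q i (Suc j) * q ^ (Suc j * j div 2) * 0) / ?L ^ i = limit_matrix q j i"
  proof -
    have "?L ^ j / ?L ^ i = (1 - q) ^ (i - j)"
      using assms True by (simp add: power_divide power_diff)
    then show ?thesis by (simp add: limit_matrix_def flip: times_divide_eq_right)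
  qed
  finally show ?thesis .
next
  case False
  then show ?thesis using assms by (simp add: aq_matrix_lower limit_matrix_def q_stirling_eq_0)
qed

lemma triangular_diff:
  fixes j k :: nat
  assumes "j \<le> k"
  shows "k * (k - 1) div 2 = j * (j - 1) div 2 + (k - j) * (k + j - 1) div 2"
proof -
  obtain d where k: "k = j + d" using le_Suc_ex[OF assms] ..
  have "k * (k - 1) = j * (j - 1) + (k - j) * (k + j - 1)"
  proof (cases j)
    case (Suc i)
    have "(Suc i + d) * (i + d) = Suc i * i + d * (i + d + Suc i)"
      by (simp add: algebra_simps)
    then show ?thesis by (simp add: k Suc)
  qed (simp add: k)
  moreover have "even (j * (j - 1))" by (cases j) auto
  ultimately show ?thesis by (simp only: div_plus_div_distrib_dvd_left)
qed

lemma limit_matrix_diag_diff: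
  assumes "0 < q" "j < k"
  shows "limit_matrix q k k - limit_matrix q j j =
    q ^ (j * (j - 1) div 2) * (q ^ ((k - j) * (k + j - 1) div 2) - 1)"
proof -
  have "q ^ (k * (k - 1) div 2) = q ^ (j * (j - 1) div 2) * q ^ ((k - j) * (k + j - 1) div 2)"
    using assms(2) by (subst triangular_diff[of j k]) (simp_all only: power_add less_imp_le)
  then show ?thesis
    using assms(1) by (simp add: limit_matrix_def q_stirling_same right_diff_distrib)
qed

text \<open>The exponent \<open>k (k - 1) / 2\<close> is strictly increasing in \<open>k\<close> except that \<open>0\<close> and \<open>1\<close>
  share the value \<open>0\<close>, which is the double eigenvalue \<open>1\<close>.\<close>
lemma limit_matrix_diag_distinct:
  assumes "0 < q" "q < 1" "2 \<le> k" "j < k"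
  shows "limit_matrix q k k \<noteq> limit_matrix q j j"
proof -
  have "1 \<le> k - j" "2 \<le> k + j - 1 \<or> (k = 2 \<and> j = 0)" using assms by auto
  then have "2 \<le> (k - j) * (k + j - 1)"
    using mult_le_mono[of 1 "k - j" 2 "k + j - 1"] by auto
  then have "0 < (k - j) * (k + j - 1) div 2" by linarith
  then have "q ^ ((k - j) * (k + j - 1) div 2) < 1"
    using power_strict_decreasing[of 0 _ q] assms by simp
  then show ?thesis
    using limit_matrix_diag_diff[OF assms(1,4)] assms(1) by auto
qed

text \<open>The factor \<open>q\<^bsup>j (j - 1) / 2\<^esup>\<close> is common to row \<open>j\<close> of the limit matrix and to the
  difference of the diagonal entries, and it cancels in each step.\<close>
lemma b_coeff_eq_back_subst:
  assumes "0 < q" "2 \<le> k" "j \<le> k"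
  shows "b_coeff q j k = back_subst (limit_matrix q) k j"
  using assms(3)
proof (induction "k - j" arbitrary: j rule: less_induct)
  case less
  show ?case
  proof (cases "j = k")
    case True
    then show ?thesis by (simp add: b_coeff.simps back_subst.simps)
  next
    case False
    then have jk: "j < k" using less.prems by simp
    have IH: "b_coeff q i k = back_subst (limit_matrix q) k i" if "i \<in> {j+1..k}" for i
      using that jk by (intro less.hyps) auto
    have "b_coeff q j k = (\<Sum>i=j+1..k. (1 - q) ^ (i - j) * q_stirling q i j
          / (q ^ ((k - j) * (k + j - 1) div 2) - 1) * back_subst (limit_matrix q) k i)"
      using jk assms(2) by (subst b_coeff.simps) (simp add: IH)
    also have "\<dots> = (\<Sum>i=j+1..k. limit_matrix q j i * back_subst (limit_matrix q) k i)
        / (limit_matrix q k k - limit_matrix q j j)"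
      unfolding limit_matrix_diag_diff[OF assms(1) jk] sum_divide_distrib
      using assms(1) by (intro sum.cong) (auto simp: limit_matrix_def)
    also have "\<dots> = back_subst (limit_matrix q) k j"
      using jk by (subst (2) back_subst.simps) simp
    finally show ?thesis .
  qed
qed

lemma eventually_aq_eigenvector_eq:
  assumes "0 < q" "q < 1" "2 \<le> k"
  shows "\<forall>\<^sub>F n in sequentially. aq_eigenvector q \<alpha> n k =
    (\<Sum>j\<le>k. monom (back_subst (aq_matrix q \<alpha> n) k j) j)"
proof -
  have "\<forall>\<^sub>F n in sequentially. aq_matrix q \<alpha> n k k - aq_matrix q \<alpha> n j j \<noteq> 0" if "j < k" for j
    using limit_matrix_diag_distinct[OF assms that]
    by (intro tendsto_imp_eventually_ne[OF tendsto_diff[OF tendsto_aq_matrix tendsto_aq_matrix]]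
      assms) auto
  then have "\<forall>\<^sub>F n in sequentially. \<forall>j\<in>{..<k}. aq_matrix q \<alpha> n k k - aq_matrix q \<alpha> n j j \<noteq> 0"
    by (intro eventually_ball_finite) auto
  moreover have "\<forall>\<^sub>F n in sequentially. k + 2 \<le> n" by (rule eventually_ge_at_top)
  ultimately show ?thesis
    by eventually_elim (use assms in \<open>auto intro!: aq_eigenvector_eq\<close>)
qed

text \<open>On a bounded set the monomials are bounded functions, so finitely many convergent
  coefficients suffice for uniform convergence.\<close>
lemma uniform_limit_poly_coeff:
  fixes p :: "nat \<Rightarrow> real poly"
  assumes "\<forall>\<^sub>F n in sequentially. degree (p n) \<le> k"
    and "\<And>j. j \<le> k \<Longrightarrow> (\<lambda>n. coeff (p n) j) \<longlonglongrightarrow> b j" and "bounded S"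
  shows "uniform_limit S (\<lambda>n. poly (p n)) (\<lambda>x. \<Sum>j\<le>k. b j * x ^ j) sequentially"
proof -
  have bdd: "bounded ((\<lambda>x. x ^ j) ` S)" for j
  proof -
    obtain B where "\<And>x. x \<in> S \<Longrightarrow> norm x \<le> B" using assms(3) by (auto simp: bounded_iff)
    then show ?thesis
      by (auto simp: bounded_iff power_abs intro!: exI[of _ "B ^ j"] power_mono)
  qed
  have "uniform_limit S (\<lambda>n x. coeff (p n) j) (\<lambda>x. b j) sequentially" if "j \<le> k" for j
    using assms(2)[OF that] by (auto simp: uniform_limit_iff tendsto_iff elim: eventually_mono)
  moreover have "bounded ((\<lambda>x. b j) ` S)" for j
    by (auto simp: bounded_iff)
  ultimately have summand: "uniform_limit S (\<lambda>n x. coeff (p n) j * x ^ j) (\<lambda>x. b j * x ^ j) sequentially"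
    if "j \<le> k" for j
    using that by (intro uniform_lim_mult bdd uniform_limit_const)
  have "uniform_limit S (\<lambda>n x. \<Sum>j\<le>m. coeff (p n) j * x ^ j) (\<lambda>x. \<Sum>j\<le>m. b j * x ^ j) sequentially"
    if "m \<le> k" for m
    using that
  proof (induction m)
    case 0
    then show ?case using summand[of 0] by simp
  next
    case (Suc m)
    then show ?case
      unfolding sum.atMost_Suc by (intro uniform_limit_add summand Suc.IH) simp_all
  qed
  then have "uniform_limit S (\<lambda>n x. \<Sum>j\<le>k. coeff (p n) j * x ^ j) (\<lambda>x. \<Sum>j\<le>k. b j * x ^ j) sequentially"
    by simp
  moreover have "\<forall>\<^sub>F n in sequentially. \<forall>x\<in>S. (\<Sum>j\<le>k. coeff (p n) j * x ^ j) = poly (p n) x"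
    using assms(1)
  proof eventually_elim
    case (elim n)
    then show ?case unfolding poly_altdef
      by (intro ballI sum.mono_neutral_right) (auto simp: coeff_eq_0)
  qed
  ultimately show ?thesis
    by (rule uniform_limit_cong[THEN iffD1, rotated -1]) auto
qed

theorem theorem4p4:
  fixes q \<alpha> :: real
  assumes "0 < q" and "q < 1" and "\<alpha> \<in> {0..1}"
  shows "(\<forall>k j. j \<le> k \<longrightarrow>
            (\<lambda>n. coeff (aq_eigenvector q \<alpha> n k) j) \<longlonglongrightarrow> b_coeff q j k) \<and>
         (\<forall>k. uniform_limit {0..1}
            (\<lambda>n x. poly (aq_eigenvector q \<alpha> n k) x)
            (\<lambda>x. \<Sum>j\<le>k. b_coeff q j k * x ^ j) sequentially)"
proof -
  have lim: "(\<lambda>n. coeff (aq_eigenvector q \<alpha> n k) j) \<longlonglongrightarrow> b_coeff q j k" if "j \<le> k" for k j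
  proof (cases "2 \<le> k")
    case True
    have "(\<lambda>n. back_subst (aq_matrix q \<alpha> n) k j) \<longlonglongrightarrow> back_subst (limit_matrix q) k j"
      using True assms by (intro tendsto_back_subst tendsto_aq_matrix limit_matrix_diag_distinct)
    also have "back_subst (limit_matrix q) k j = b_coeff q j k"
      using True assms that by (simp add: b_coeff_eq_back_subst)
    finally show ?thesis
      by (rule Lim_transform_eventually)
        (use eventually_aq_eigenvector_eq[OF assms(1,2) True, of \<alpha>] in
          \<open>eventually_elim, simp only: coeff_sum_monom that if_True\<close>)
  next
    case False
    then have "k = 0 \<or> k = 1 \<and> (j = 0 \<or> j = 1)" using that by auto
    then show ?thesis using that by (auto simp: aq_eigenvector_def b_coeff.simps)
  qed
  have deg: "\<forall>\<^sub>F n in sequentially. degree (aq_eigenvector q \<alpha> n k) \<le> k" for k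
  proof (cases "2 \<le> k")
    case True
    show ?thesis
      using eventually_aq_eigenvector_eq[OF assms(1,2) True, of \<alpha>]
      by eventually_elim (auto intro!: degree_le simp: coeff_sum_monom)
  next
    case False
    then have "k = 0 \<or> k = 1" by auto
    then show ?thesis by (auto simp: aq_eigenvector_def)
  qed
  show ?thesis
    using lim by (auto intro!: uniform_limit_poly_coeff deg)
qed

end
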